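(* The equations $$\left[(1-c)\nu+\frac c6\right]u_{\xi\xi}=-\frac34u^2+(c-1)u+\mathcal{A}_1\qquad(\mathrm{I})$$ and $$(\delta_2-c\delta_1)u_{\xi\xi\xi\xi}+\frac c6u_{\xi\xi}+\left(2\gamma-\frac1{12}\right)u_\xi^2+2\gamma\,u\,u_{\xi\xi}=\frac14u^3-\frac34u^2-(1-c)u+\mathcal{B}_1\qquad(\mathrm{II})$$ admit solutions which satisfy the elliptic equation $$u_\xi^2=\sum_{i=0}^3a_iu^i\equiv q_3(u),$$ where the $a_i$ are constants that depend on the parameters $\nu,\gamma,\delta_1,\delta_2$, the boundary conditions $\mathcal{A}_0,\mathcal{A}_1,\mathcal{B}_1$ respectively, and the wave speed $c$.
   Context: Equations (I) and (II) are the once-integrated traveling-wave reductions, with $u=u(\xi)$, $\xi=x-ct$ and $c$ the wave speed, of the third-order KdV--BBM equation $u_t+u_x+\frac32uu_x+\nu u_{xxx}-\left(\frac16-\nu\right)u_{xxt}=0$ and of the fifth-order KdV--BBM equation $u_{t}+u_{x}-\frac16u_{xxt}+\delta_1u_{xxxxt}+\delta_2u_{xxxxx}+\left(\frac34u^2+\gamma(u^2)_{xx}-\frac1{12}u_x^2-\frac14u^3\right)_x=0$, respectively, where $\nu,\gamma,\delta_1,\delta_2$ are parameters of these equations. The constants $\mathcal{A}_1$ and $\mathcal{B}_1$ are the constants of that integration (they are zero if one assumes zero boundary conditions), and $\mathcal{A}_0$ is the constant of integration that arises when (I) is multiplied by $2u_\xi$ and integrated once more.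
   Formalization: For (I), (1-c)ν+c/6≠0 is assumed, since otherwise (I) is algebraic and may have no real solution; solutions are real and local, and for (II) they are shown nonconstant only for nonresonant parameters (otherwise a constant solution is allowed). *)

theory Defs
  imports "HOL-Analysis.Analysis"
begin

definition times_differentiable_on :: "nat \<Rightarrow> (real \<Rightarrow> real) \<Rightarrow> real set \<Rightarrow> bool" where
  "times_differentiable_on n u S \<longleftrightarrow>
     (\<forall>k<n. \<forall>\<xi>\<in>S. (deriv ^^ k) u field_differentiable (at \<xi>))"

definition solves_third_order ::
    "real \<Rightarrow> real \<Rightarrow> real \<Rightarrow> (real \<Rightarrow> real) \<Rightarrow> real set \<Rightarrow> bool" where
  "solves_third_order \<nu> c A1 u S \<longleftrightarrow> times_differentiable_on 2 u S \<and>
     (\<forall>\<xi>\<in>S. ((1 - c) * \<nu> + c / 6) * (deriv ^^ 2) u \<xi> =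
        - (3 / 4) * (u \<xi>)\<^sup>2 + (c - 1) * u \<xi> + A1)"

text \<open>\<open>A0\<close> is the constant obtained by multiplying the third-order reduction by \<open>2 u\<^sub>\<xi>\<close>
  and integrating once; the primitive of the right-hand side is normalised to have
  no constant term in \<open>u\<close>.\<close>

definition has_second_integration_constant ::
    "real \<Rightarrow> real \<Rightarrow> real \<Rightarrow> real \<Rightarrow> (real \<Rightarrow> real) \<Rightarrow> real set \<Rightarrow> bool" where
  "has_second_integration_constant \<nu> c A1 A0 u S \<longleftrightarrow>
     (\<forall>\<xi>\<in>S. ((1 - c) * \<nu> + c / 6) * (deriv u \<xi>)\<^sup>2 =
        - (1 / 2) * (u \<xi>) ^ 3 + (c - 1) * (u \<xi>)\<^sup>2 + 2 * A1 * u \<xi> + A0)"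

definition solves_fifth_order ::
    "real \<Rightarrow> real \<Rightarrow> real \<Rightarrow> real \<Rightarrow> real \<Rightarrow> (real \<Rightarrow> real) \<Rightarrow> real set \<Rightarrow> bool" where
  "solves_fifth_order \<gamma> \<delta>1 \<delta>2 c B1 u S \<longleftrightarrow> times_differentiable_on 4 u S \<and>
     (\<forall>\<xi>\<in>S. (\<delta>2 - c * \<delta>1) * (deriv ^^ 4) u \<xi> + c / 6 * (deriv ^^ 2) u \<xi>
          + (2 * \<gamma> - 1 / 12) * (deriv u \<xi>)\<^sup>2 + 2 * \<gamma> * u \<xi> * (deriv ^^ 2) u \<xi> =
        1 / 4 * (u \<xi>) ^ 3 - 3 / 4 * (u \<xi>)\<^sup>2 - (1 - c) * u \<xi> + B1)"

definition satisfies_elliptic :: "(nat \<Rightarrow> real) \<Rightarrow> (real \<Rightarrow> real) \<Rightarrow> real set \<Rightarrow> bool" where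
  "satisfies_elliptic a u S \<longleftrightarrow> times_differentiable_on 1 u S \<and>
     (\<forall>\<xi>\<in>S. (deriv u \<xi>)\<^sup>2 = (\<Sum>i=0..3. a i * (u \<xi>) ^ i))"

text \<open>Inserting the elliptic equation into the fifth-order reduction and comparing powers
  of \<open>u\<close> gives, with \<open>D = \<delta>2 - c \<delta>1\<close>, the quadratic
  \<open>15/2 D a\<^sub>3\<^sup>2 + (5\<gamma> - 1/12) a\<^sub>3 = 1/4\<close>, followed by equations that are linear in
  \<open>a\<^sub>2\<close>, \<open>a\<^sub>1\<close>, \<open>a\<^sub>0\<close> in turn, with leading coefficients \<open>15/2 D a\<^sub>3 + 4\<gamma> - 1/12\<close>,
  \<open>9/2 D a\<^sub>3 + 3\<gamma> - 1/12\<close> and \<open>3 D a\<^sub>3 + 2\<gamma> - 1/12\<close>.  A real square root \<open>w\<close> of the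
  discriminant selects the root \<open>a\<^sub>3 = 1 / (2 (w + 5\<gamma> - 1/12))\<close>, for which
  \<open>D a\<^sub>3 = (w - 5\<gamma> + 1/12) / 15\<close>; the four exclusions below say that \<open>a\<^sub>3\<close> is finite and
  that the three leading coefficients do not vanish.\<close>

definition nonresonant :: "real \<Rightarrow> real \<Rightarrow> real \<Rightarrow> real \<Rightarrow> bool" where
  "nonresonant \<gamma> \<delta>1 \<delta>2 c \<longleftrightarrow>
     (\<exists>w. w\<^sup>2 = (5 * \<gamma> - 1 / 12)\<^sup>2 + 15 / 2 * (\<delta>2 - c * \<delta>1) \<and>
        w \<noteq> 1 / 12 - 5 * \<gamma> \<and> w \<noteq> 1 / 12 - 3 * \<gamma> \<and>
        w \<noteq> 7 / 36 - 5 * \<gamma> \<and> w \<noteq> 1 / 3 - 5 * \<gamma>)"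

end

theory Submission
  imports Defs
begin

text \<open>Both reductions follow from the elliptic equation \<open>u'\<^sup>2 = q(u)\<close>, \<open>q(y) = \<Sum>i\<le>3. a\<^sub>i y\<^sup>i\<close>, by
  differentiation.  Where \<open>u' \<noteq> 0\<close> one gets \<open>2 u'' = q'(u)\<close>, and differentiating twice more,
  \<open>u'''' = 3 a\<^sub>3 q(u) + (a\<^sub>2 + 3 a\<^sub>3 u) u''\<close>.  So each reduction becomes a polynomial identity in \<open>u\<close>
  of degree at most three, and it remains to choose the \<open>a\<^sub>i\<close>.

  For the third-order reduction \<open>q\<close> comes from multiplying the right-hand side by \<open>2 u'\<close>,
  integrating with constant \<open>A0\<close> and dividing by \<open>(1 - c)\<nu> + c/6\<close>.  For the fifth-order
  reduction, comparing coefficients gives a triangular system for \<open>a\<^sub>3, a\<^sub>2, a\<^sub>1, a\<^sub>0\<close>, which for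
  nonresonant parameters has a solution with \<open>a\<^sub>3 \<noteq> 0\<close> (\<open>nonresonant_coefficients\<close>).  For the
  other parameters a constant solution is used: a real root of the cubic right-hand side.

  What is left is a nonconstant solution of \<open>u'\<^sup>2 = q(u)\<close> when \<open>a\<^sub>3 \<noteq> 0\<close>.  A cubic takes a positive
  value (\<open>cubic_surj\<close>), and near such a value \<open>u' = sqrt (q(u))\<close> is a separable equation with
  positive continuous right-hand side, solved by inverting a primitive of \<open>1 / sqrt q\<close>
  (\<open>separable_ode_solution\<close>).\<close>

section \<open>Values of real cubics\<close>

lemma cubic_ge:
  fixes a0 a1 a2 a3 v :: real
  assumes "a3 \<noteq> 0"
  shows "\<exists>y. v \<le> a0 + a1 * y + a2 * y\<^sup>2 + a3 * y ^ 3"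
proof -
  (* At y = sgn a3 * T with T \<ge> 1 the cubic term equals |a3| T^3, while v, a0, a1 y and a2 y^2
     are together at most M T^2 in absolute value; T is chosen so that |a3| T \<ge> M. *)
  define M where "M = \<bar>a0\<bar> + \<bar>a1\<bar> + \<bar>a2\<bar> + \<bar>v\<bar>"
  define T where "T = 1 + M / \<bar>a3\<bar>"
  have T1: "T \<ge> 1" and M: "M \<le> \<bar>a3\<bar> * T"
    using assms by (auto simp: T_def M_def field_simps)
  have T2: "T \<le> T\<^sup>2" "1 \<le> T\<^sup>2" using T1 by (simp_all add: power2_eq_square mult_ge1_I)
  define y where "y = sgn a3 * T"
  have y2: "y\<^sup>2 = T\<^sup>2" and y3: "a3 * y ^ 3 = \<bar>a3\<bar> * T * T\<^sup>2" and ya: "\<bar>y\<bar> = T"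
    using assms T1 by (auto simp: y_def sgn_if power2_eq_square power3_eq_cube abs_if)
  have "- a1 * y \<le> \<bar>a1\<bar> * T\<^sup>2"
  proof -
    have "- a1 * y \<le> \<bar>a1\<bar> * \<bar>y\<bar>" by (metis abs_ge_self abs_minus_cancel abs_mult)
    also have "\<dots> \<le> \<bar>a1\<bar> * T\<^sup>2" unfolding ya using T2 by (intro mult_left_mono) auto
    finally show ?thesis .
  qed
  moreover have "v - a0 \<le> (\<bar>v\<bar> + \<bar>a0\<bar>) * 1" by simp
  moreover have "(\<bar>v\<bar> + \<bar>a0\<bar>) * 1 \<le> (\<bar>v\<bar> + \<bar>a0\<bar>) * T\<^sup>2"
    using T2 by (intro mult_left_mono) auto
  moreover have "- a2 * y\<^sup>2 \<le> \<bar>a2\<bar> * T\<^sup>2"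
    unfolding y2 by (intro mult_right_mono) auto
  moreover have "M * T\<^sup>2 \<le> a3 * y ^ 3"
    unfolding y3 using M by (intro mult_right_mono) auto
  ultimately have "v \<le> a0 + a1 * y + a2 * y\<^sup>2 + a3 * y ^ 3"
    by (simp add: M_def algebra_simps)
  then show ?thesis ..
qed

lemma cubic_surj:
  fixes a0 a1 a2 a3 v :: real
  assumes "a3 \<noteq> 0"
  shows "\<exists>y. a0 + a1 * y + a2 * y\<^sup>2 + a3 * y ^ 3 = v"
proof -
  let ?f = "\<lambda>y. a0 + a1 * y + a2 * y\<^sup>2 + a3 * y ^ 3"
  obtain y where y: "v \<le> ?f y" using cubic_ge[OF assms] by blast
  (* The negated cubic is at least - v somewhere, which bounds the cubic itself from the other side. *)
  obtain z where "- v \<le> - a0 + - a1 * z + - a2 * z\<^sup>2 + - a3 * z ^ 3"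
    using cubic_ge[of "- a3" "- v"] assms by (metis neg_equal_0_iff_equal)
  then have z: "?f z \<le> v" by simp
  have "connected (range ?f)"
    by (intro connected_continuous_image continuous_intros connected_UNIV)
  then have "v \<in> range ?f"
    using y z unfolding connected_iff_interval by blast
  then show ?thesis by auto
qed

section \<open>Solutions of the elliptic equation\<close>

text \<open>Separation of variables: \<open>u\<close> is the inverse of the time \<open>F\<close> that a trajectory takes to
  reach a given height, \<open>F' = 1 / f\<close>.\<close>

lemma separable_ode_solution:
  fixes f :: "real \<Rightarrow> real"
  assumes "a < b" and cont: "continuous_on {a..b} f" and pos: "\<And>y. y \<in> {a..b} \<Longrightarrow> f y > 0"
  shows "\<exists>u l h. l < h \<and>
    (\<forall>x\<in>{l<..<h}. u x \<in> {a<..<b} \<and> (u has_real_derivative f (u x)) (at x))"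
proof -
  have "continuous_on {a..b} (\<lambda>y. 1 / f y)"
    using cont pos by (intro continuous_intros) (auto simp: less_imp_neq[THEN not_sym])
  then obtain F where F: "\<And>y. y \<in> {a..b} \<Longrightarrow>
      (F has_vector_derivative 1 / f y) (at y within {a..b})"
    using antiderivative_continuous by blast
  have DF: "(F has_real_derivative 1 / f y) (at y)" if "y \<in> {a<..<b}" for y
    using F[of y] that by (simp add: has_real_derivative_iff_has_vector_derivative
        at_within_Icc_at)
  have mono: "F y < F z" if "y \<in> {a<..<b}" "z \<in> {a<..<b}" "y < z" for y z
  proof (rule DERIV_pos_imp_increasing[OF \<open>y < z\<close>])
    fix x assume "y \<le> x" "x \<le> z"
    then have "x \<in> {a<..<b}" using that by auto
    then show "\<exists>d. (F has_real_derivative d) (at x) \<and> 0 < d"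
      using DF pos[of x] by (intro exI[of _ "1 / f x"]) auto
  qed
  have inj: "inj_on F {a<..<b}"
    by (rule linorder_inj_onI') (use mono in force)
  define u where "u = the_inv_into {a<..<b} F"
  have uF: "u (F y) = y" if "y \<in> {a<..<b}" for y
    unfolding u_def using the_inv_into_f_f[OF inj that] .
  have Du: "(u has_real_derivative f y) (at (F y))" if y: "y \<in> {a<..<b}" for y
  proof -
    have "(u has_derivative (*) (f y)) (at (F y))"
    proof (rule has_derivative_inverse_on[where S = "{a<..<b}" and f = F
          and f' = "\<lambda>y. (*) (1 / f y)" and g' = "\<lambda>y. (*) (f y)"])
      show "(F has_derivative (*) (1 / f x)) (at x)" if "x \<in> {a<..<b}" for x
        using DF[OF that] by (simp add: has_field_derivative_def)
      show "(*) (1 / f y) \<circ> (*) (f y) = id"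
        using pos[of y] y by (auto simp: fun_eq_iff)
    qed (use y uF in auto)
    then show ?thesis by (simp add: has_field_derivative_def)
  qed
  (* The times at which heights m and M are reached bound the time interval; by the intermediate
     value theorem every time in between is F y for some height y. *)
  obtain m where m: "a < m" "m < b" using dense[OF \<open>a < b\<close>] by blast
  obtain M where M: "m < M" "M < b" using dense[OF \<open>m < b\<close>] by blast
  have "F m < F M" using mono m M by simp
  moreover have "u x \<in> {a<..<b} \<and> (u has_real_derivative f (u x)) (at x)"
    if x: "x \<in> {F m<..<F M}" for x
  proof -
    have "continuous_on {m..M} F"
      using m M by (intro continuous_at_imp_continuous_on ballI DERIV_isCont[OF DF]) auto
    then obtain y where "m \<le> y" "y \<le> M" "F y = x"
      using IVT'[of F m x M] x M by auto
    then show ?thesis using Du[of y] uF[of y] m M by auto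
  qed
  ultimately show ?thesis by blast
qed

text \<open>Openness of \<open>S\<close> matters: \<open>(deriv ^^ k) (f 0)\<close> is known to agree with \<open>f k\<close> on \<open>S\<close> only, and
  this determines the next derivative because \<open>S\<close> is a neighbourhood of each of its points.\<close>

lemma iterated_deriv_from_chain:
  fixes f :: "nat \<Rightarrow> real \<Rightarrow> real"
  assumes "open S"
    and D: "\<And>k x. k < n \<Longrightarrow> x \<in> S \<Longrightarrow> (f k has_real_derivative f (Suc k) x) (at x)"
  shows "times_differentiable_on n (f 0) S"
    and "k \<le> n \<Longrightarrow> x \<in> S \<Longrightarrow> (deriv ^^ k) (f 0) x = f k x"
proof -
  have eq: "(deriv ^^ k) (f 0) x = f k x" if "k \<le> n" "x \<in> S" for k x
    using that
  proof (induction k arbitrary: x)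
    case (Suc k)
    have "((deriv ^^ k) (f 0) has_real_derivative f (Suc k) x) (at x)"
      by (rule has_field_derivative_transform_within_open[OF D \<open>open S\<close>]) (use Suc in auto)
    then show ?case by (simp add: DERIV_imp_deriv)
  qed simp
  show "times_differentiable_on n (f 0) S"
    unfolding times_differentiable_on_def
  proof (intro allI impI ballI)
    fix k x assume k: "k < n" and x: "x \<in> S"
    have "((deriv ^^ k) (f 0) has_real_derivative f (Suc k) x) (at x)"
      by (rule has_field_derivative_transform_within_open[OF D \<open>open S\<close>]) (use k x eq in auto)
    then show "(deriv ^^ k) (f 0) field_differentiable at x"
      by (auto simp: field_differentiable_def)
  qed
  show "k \<le> n \<Longrightarrow> x \<in> S \<Longrightarrow> (deriv ^^ k) (f 0) x = f k x" by (rule eq)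
qed

text \<open>The solution stays where the cubic is positive, so \<open>u' = sqrt (q u)\<close> can be differentiated,
  and the square roots cancel in the derivatives of even order.\<close>

lemma elliptic_solution:
  fixes a0 a1 a2 a3 :: real
  assumes "a3 \<noteq> 0"
  defines "q \<equiv> \<lambda>y. a0 + a1 * y + a2 * y\<^sup>2 + a3 * y ^ 3"
    and "g \<equiv> \<lambda>y. a1 / 2 + a2 * y + 3 / 2 * a3 * y\<^sup>2"
  obtains u l h where "l < h" "times_differentiable_on 4 u {l<..<h}"
    "\<And>x. x \<in> {l<..<h} \<Longrightarrow> (deriv u x)\<^sup>2 = q (u x)"
    "\<And>x. x \<in> {l<..<h} \<Longrightarrow> (deriv ^^ 2) u x = g (u x)"
    "\<And>x. x \<in> {l<..<h} \<Longrightarrow> (deriv ^^ 4) u x = 3 * a3 * q (u x) + (a2 + 3 * a3 * u x) * g (u x)"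
    "\<not> u constant_on {l<..<h}"
proof -
  have contq: "continuous_on S q" for S
    unfolding q_def by (intro continuous_intros)
  obtain y0 where "q y0 = 1" using cubic_surj[OF assms(1)] unfolding q_def by blast
  moreover have "open {y. 0 < q y}"
    by (intro open_Collect_less contq continuous_intros)
  moreover from calculation have "y0 \<in> {y. 0 < q y}" by simp
  ultimately obtain e where e: "e > 0" "cball y0 e \<subseteq> {y. 0 < q y}"
    by (meson open_contains_cball)
  then have pos: "q y > 0" if "y \<in> {y0 - e..y0 + e}" for y
    using that by (auto simp: cball_eq_atLeastAtMost)
  have "\<exists>u l h. l < h \<and> (\<forall>x\<in>{l<..<h}. u x \<in> {y0 - e<..<y0 + e} \<and>
      (u has_real_derivative sqrt (q (u x))) (at x))"
    using e(1) pos by (intro separable_ode_solution continuous_intros contq) auto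
  then obtain u l h where lh: "l < h" and
    u: "\<And>x. x \<in> {l<..<h} \<Longrightarrow> u x \<in> {y0 - e<..<y0 + e}" and
    Du: "\<And>x. x \<in> {l<..<h} \<Longrightarrow> (u has_real_derivative sqrt (q (u x))) (at x)"
    by blast
  have qpos: "q (u x) > 0" if "x \<in> {l<..<h}" for x
    using pos u[OF that] by auto
  (* The successive derivatives of u, with u' replaced by sqrt (q u) throughout. *)
  define f where "f k = ([u, \<lambda>x. sqrt (q (u x)), \<lambda>x. g (u x),
      \<lambda>x. (a2 + 3 * a3 * u x) * sqrt (q (u x)),
      \<lambda>x. 3 * a3 * q (u x) + (a2 + 3 * a3 * u x) * g (u x)] ! k)" for k
  have Dq: "((\<lambda>x. q (u x)) has_real_derivative 2 * g (u x) * sqrt (q (u x))) (at x)"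
    if "x \<in> {l<..<h}" for x
    unfolding q_def g_def
    by (rule derivative_eq_intros Du[OF that] refl)+ (simp add: q_def algebra_simps power2_eq_square)
  have Dsqrt: "((\<lambda>x. sqrt (q (u x))) has_real_derivative g (u x)) (at x)"
    if "x \<in> {l<..<h}" for x
    by (rule DERIV_cong[OF DERIV_chain2[OF DERIV_real_sqrt[OF qpos[OF that]] Dq[OF that]]])
      (use qpos[OF that] in simp)
  have Dg: "((\<lambda>x. g (u x)) has_real_derivative (a2 + 3 * a3 * u x) * sqrt (q (u x))) (at x)"
    if "x \<in> {l<..<h}" for x
    unfolding g_def
    by (rule derivative_eq_intros Du[OF that] refl)+ (simp add: algebra_simps)
  have D3: "((\<lambda>x. (a2 + 3 * a3 * u x) * sqrt (q (u x))) has_real_derivative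
      3 * a3 * q (u x) + (a2 + 3 * a3 * u x) * g (u x)) (at x)"
    if "x \<in> {l<..<h}" for x
    by (rule derivative_eq_intros Du[OF that] Dsqrt[OF that] refl)+
      (use qpos[OF that] in \<open>simp add: algebra_simps\<close>)
  have chain: "(f k has_real_derivative f (Suc k) x) (at x)" if "k < 4" "x \<in> {l<..<h}" for k x
  proof -
    consider "k = 0" | "k = 1" | "k = 2" | "k = 3" using \<open>k < 4\<close> by linarith
    then show ?thesis
      by cases (use Du Dsqrt Dg D3 that in \<open>simp_all add: f_def numeral_3_eq_3 numeral_2_eq_2\<close>)
  qed
  have f0: "f 0 = u" by (simp add: f_def)
  note ch = iterated_deriv_from_chain[of "{l<..<h}" 4 f, OF _ chain, unfolded f0]
  have d: "(deriv ^^ k) u x = f k x" if "x \<in> {l<..<h}" "k \<le> 4" for k x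
    using ch(2) that by simp
  show ?thesis
  proof
    show "l < h" by fact
    show "times_differentiable_on 4 u {l<..<h}" using ch(1) by simp
    fix x assume x: "x \<in> {l<..<h}"
    show "(deriv u x)\<^sup>2 = q (u x)"
      using DERIV_imp_deriv[OF Du[OF x]] qpos[OF x] by simp
    show "(deriv ^^ 2) u x = g (u x)"
      using d[OF x, of 2] by (simp add: f_def)
    show "(deriv ^^ 4) u x = 3 * a3 * q (u x) + (a2 + 3 * a3 * u x) * g (u x)"
      using d[OF x, of 4] by (simp add: f_def)
  next
    show "\<not> u constant_on {l<..<h}"
    proof
      assume "u constant_on {l<..<h}"
      then obtain v where v: "\<And>x. x \<in> {l<..<h} \<Longrightarrow> u x = v"
        by (auto simp: constant_on_def)
      obtain x where x: "x \<in> {l<..<h}" using dense[OF lh] by auto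
      have "(u has_real_derivative 0) (at x)"
        by (rule has_field_derivative_transform_within_open[of "\<lambda>_. v" _ _ "{l<..<h}"])
          (use x v in auto)
      then have "sqrt (q (u x)) = 0" using DERIV_unique Du[OF x] by blast
      then show False using qpos[OF x] by simp
    qed
  qed
qed

lemma times_differentiable_on_mono:
  "times_differentiable_on n u S \<Longrightarrow> m \<le> n \<Longrightarrow> times_differentiable_on m u S"
  by (auto simp: times_differentiable_on_def)

lemma satisfies_elliptic_cubicI:
  assumes "times_differentiable_on 1 u S"
    and "\<And>x. x \<in> S \<Longrightarrow> (deriv u x)\<^sup>2 = a0 + a1 * u x + a2 * (u x)\<^sup>2 + a3 * u x ^ 3"
  shows "satisfies_elliptic (\<lambda>i. [a0, a1, a2, a3] ! i) u S"
proof -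
  have "sum f {0..3} = f 0 + f 1 + f 2 + f 3" for f :: "nat \<Rightarrow> real"
    by (simp add: numeral_3_eq_3 numeral_2_eq_2)
  then show ?thesis
    using assms by (simp add: satisfies_elliptic_def)
qed

section \<open>The third-order reduction\<close>

lemma third_order_elliptic_solution:
  assumes "(1 - c) * \<nu> + c / 6 \<noteq> 0"
  shows "\<exists>a u l h. l < h \<and> solves_third_order \<nu> c A1 u {l<..<h} \<and>
    has_second_integration_constant \<nu> c A1 A0 u {l<..<h} \<and>
    satisfies_elliptic a u {l<..<h} \<and> \<not> u constant_on {l<..<h}"
proof -
  define K where "K = (1 - c) * \<nu> + c / 6"
  have K0: "K \<noteq> 0" using assms by (simp add: K_def)
  obtain u l h where lh: "l < h" and td: "times_differentiable_on 4 u {l<..<h}"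
    and e1: "\<And>x. x \<in> {l<..<h} \<Longrightarrow> (deriv u x)\<^sup>2 =
      A0 / K + 2 * A1 / K * u x + (c - 1) / K * (u x)\<^sup>2 + - 1 / (2 * K) * u x ^ 3"
    and e2: "\<And>x. x \<in> {l<..<h} \<Longrightarrow> (deriv ^^ 2) u x =
      2 * A1 / K / 2 + (c - 1) / K * u x + 3 / 2 * (- 1 / (2 * K)) * (u x)\<^sup>2"
    and nc: "\<not> u constant_on {l<..<h}"
    by (rule elliptic_solution[of "- 1 / (2 * K)" "A0 / K" "2 * A1 / K" "(c - 1) / K"])
      (use K0 in auto)
  let ?a = "\<lambda>i. [A0 / K, 2 * A1 / K, (c - 1) / K, - 1 / (2 * K)] ! i"
  have "solves_third_order \<nu> c A1 u {l<..<h}"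
    unfolding solves_third_order_def K_def[symmetric]
    using times_differentiable_on_mono[OF td] K0 by (simp add: e2 field_simps)
  moreover have "has_second_integration_constant \<nu> c A1 A0 u {l<..<h}"
    unfolding has_second_integration_constant_def K_def[symmetric]
    using K0 by (simp add: e1 field_simps)
  moreover have "satisfies_elliptic ?a u {l<..<h}"
    by (rule satisfies_elliptic_cubicI[OF times_differentiable_on_mono[OF td] e1]) simp
  ultimately show ?thesis using lh nc by blast
qed

section \<open>The fifth-order reduction\<close>

text \<open>With \<open>D = \<delta>2 - c \<delta>1\<close>, the four equations are the coefficients of \<open>u\<^sup>3, u\<^sup>2, u, 1\<close> after the
  derivatives have been eliminated from the fifth-order reduction.  Writing
  \<open>p = 5\<gamma> - 1/12\<close>, the discriminant condition reads \<open>15/2 D = (w - p)(w + p)\<close>, so that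
  \<open>D a\<^sub>3 = (w - p)/15\<close> and no division by \<open>D\<close> occurs: the case \<open>D = 0\<close> is covered.  In terms of
  \<open>w\<close> the factors of \<open>a\<^sub>2, a\<^sub>1, a\<^sub>0\<close> are \<open>(w + 3\<gamma> - 1/12)/2\<close>, \<open>3/10 (w + 5\<gamma> - 7/36)\<close> and
  \<open>(w + 5\<gamma> - 1/3)/5\<close>, all nonzero.\<close>

lemma nonresonant_coefficients:
  assumes "nonresonant \<gamma> \<delta>1 \<delta>2 c"
  defines "D \<equiv> \<delta>2 - c * \<delta>1"
  obtains a0 a1 a2 a3 where "a3 \<noteq> 0"
    "15/2 * D * a3\<^sup>2 + (5 * \<gamma> - 1/12) * a3 = 1/4"
    "(15/2 * (D * a3) + 4 * \<gamma> - 1/12) * a2 = - 3/4 - c / 4 * a3"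
    "(9/2 * (D * a3) + 3 * \<gamma> - 1/12) * a1 = c - 1 - D * a2\<^sup>2 - c / 6 * a2"
    "(3 * (D * a3) + 2 * \<gamma> - 1/12) * a0 = B1 - D * a1 * a2 / 2 - c / 12 * a1"
proof -
  obtain w where w: "w\<^sup>2 = (5 * \<gamma> - 1 / 12)\<^sup>2 + 15 / 2 * D"
    and nz: "w \<noteq> 1 / 12 - 5 * \<gamma>" "w \<noteq> 1 / 12 - 3 * \<gamma>"
      "w \<noteq> 7 / 36 - 5 * \<gamma>" "w \<noteq> 1 / 3 - 5 * \<gamma>"
    using assms(1) unfolding nonresonant_def D_def by blast
  define p where "p = 5 * \<gamma> - 1/12"
  have wp: "w + p \<noteq> 0" using nz(1) by (simp add: p_def)
  define a3 where "a3 = 1 / (2 * (w + p))"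
  have a3: "a3 \<noteq> 0" "2 * (w + p) * a3 = 1" using wp by (auto simp: a3_def)
  have D15: "15/2 * D = (w - p) * (w + p)"
    using w[folded p_def] by (simp add: algebra_simps power2_eq_square)
  then have Da: "D * a3 = (w - p) / 15"
    using wp unfolding a3_def by (simp add: field_simps)
  have "15/2 * D * a3\<^sup>2 + p * a3 = (15/2 * (D * a3) + p) * a3"
    by (simp add: algebra_simps power2_eq_square)
  also have "\<dots> = (2 * (w + p) * a3) / 4"
    unfolding Da by (simp add: field_simps)
  also have "\<dots> = 1/4" by (simp only: a3(2))
  finally have e3: "15/2 * D * a3\<^sup>2 + (5 * \<gamma> - 1/12) * a3 = 1/4"
    by (simp only: p_def)
  have "15/2 * (D * a3) + 4 * \<gamma> - 1/12 \<noteq> 0" "9/2 * (D * a3) + 3 * \<gamma> - 1/12 \<noteq> 0"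
    "3 * (D * a3) + 2 * \<gamma> - 1/12 \<noteq> 0"
    unfolding Da using nz by (auto simp: p_def field_simps)
  moreover have "\<exists>x. k * x = r" if "k \<noteq> 0" for k r :: real
    using that by (intro exI[of _ "r / k"]) simp
  ultimately show ?thesis
    using that[OF a3(1) e3] by meson
qed

lemma fifth_order_elliptic_solution_nonresonant:
  assumes "nonresonant \<gamma> \<delta>1 \<delta>2 c"
  shows "\<exists>b u l h. l < h \<and> solves_fifth_order \<gamma> \<delta>1 \<delta>2 c B1 u {l<..<h} \<and>
    satisfies_elliptic b u {l<..<h} \<and> \<not> u constant_on {l<..<h}"
proof -
  define D where "D = \<delta>2 - c * \<delta>1"
  obtain a0 a1 a2 a3 where a3: "a3 \<noteq> 0"
    and c3: "15/2 * D * a3\<^sup>2 + (5 * \<gamma> - 1/12) * a3 = 1/4"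
    and c2: "(15/2 * (D * a3) + 4 * \<gamma> - 1/12) * a2 = - 3/4 - c / 4 * a3"
    and c1: "(9/2 * (D * a3) + 3 * \<gamma> - 1/12) * a1 = c - 1 - D * a2\<^sup>2 - c / 6 * a2"
    and c0: "(3 * (D * a3) + 2 * \<gamma> - 1/12) * a0 = B1 - D * a1 * a2 / 2 - c / 12 * a1"
    unfolding D_def by (rule nonresonant_coefficients[OF assms])
  define q where "q y = a0 + a1 * y + a2 * y\<^sup>2 + a3 * y ^ 3" for y
  define g where "g y = a1 / 2 + a2 * y + 3 / 2 * a3 * y\<^sup>2" for y
  obtain u l h where lh: "l < h" and td: "times_differentiable_on 4 u {l<..<h}"
    and e1: "\<And>x. x \<in> {l<..<h} \<Longrightarrow> (deriv u x)\<^sup>2 = q (u x)"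
    and e2: "\<And>x. x \<in> {l<..<h} \<Longrightarrow> (deriv ^^ 2) u x = g (u x)"
    and e4: "\<And>x. x \<in> {l<..<h} \<Longrightarrow>
      (deriv ^^ 4) u x = 3 * a3 * q (u x) + (a2 + 3 * a3 * u x) * g (u x)"
    and nc: "\<not> u constant_on {l<..<h}"
    by (rule elliptic_solution[OF a3, where ?a0.0 = a0 and ?a1.0 = a1 and ?a2.0 = a2])
      (rule that; unfold q_def g_def; assumption)
  (* The fifth-order reduction as an identity in y = u, after eliminating the derivatives. *)
  have key: "D * (3 * a3 * q y + (a2 + 3 * a3 * y) * g y) + c / 6 * g y
      + (2 * \<gamma> - 1 / 12) * q y + 2 * \<gamma> * y * g y
      = 1 / 4 * y ^ 3 - 3 / 4 * y\<^sup>2 - (1 - c) * y + B1" for y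
  proof -
    have "D * (3 * a3 * q y + (a2 + 3 * a3 * y) * g y) + c / 6 * g y
        + (2 * \<gamma> - 1 / 12) * q y + 2 * \<gamma> * y * g y
      = (15/2 * D * a3\<^sup>2 + (5 * \<gamma> - 1/12) * a3) * y ^ 3
      + ((15/2 * (D * a3) + 4 * \<gamma> - 1/12) * a2 + c / 4 * a3) * y\<^sup>2
      + ((9/2 * (D * a3) + 3 * \<gamma> - 1/12) * a1 + D * a2\<^sup>2 + c / 6 * a2) * y
      + ((3 * (D * a3) + 2 * \<gamma> - 1/12) * a0 + D * a1 * a2 / 2 + c / 12 * a1)"
      unfolding q_def g_def by (simp add: field_simps power2_eq_square power3_eq_cube)
    then show ?thesis unfolding c3 c2 c1 c0 by (simp add: algebra_simps)
  qed
  have "solves_fifth_order \<gamma> \<delta>1 \<delta>2 c B1 u {l<..<h}"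
    unfolding solves_fifth_order_def D_def[symmetric] using td key by (simp add: e1 e2 e4)
  moreover have "satisfies_elliptic (\<lambda>i. [a0, a1, a2, a3] ! i) u {l<..<h}"
    by (rule satisfies_elliptic_cubicI[OF times_differentiable_on_mono[OF td] e1[unfolded q_def]]) simp
  ultimately show ?thesis using lh nc by blast
qed

lemma times_differentiable_on_const: "times_differentiable_on n (\<lambda>_. v) S"
  and iterated_deriv_const: "k > 0 \<Longrightarrow> (deriv ^^ k) (\<lambda>_. v :: real) = (\<lambda>_. 0)"
proof -
  have *: "(deriv ^^ k) (\<lambda>_. v) = (\<lambda>_. if k = 0 then v else 0)" for k and v :: real
    by (induction k) auto
  show "times_differentiable_on n (\<lambda>_. v) S"
    by (simp add: times_differentiable_on_def *)
  show "k > 0 \<Longrightarrow> (deriv ^^ k) (\<lambda>_. v :: real) = (\<lambda>_. 0)"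
    by (simp add: *)
qed

text \<open>For constant \<open>u\<close> the left-hand side of the reduction vanishes, and a cubic has a real root.
  A constant satisfies the elliptic equation with \<open>q = 0\<close>.\<close>

lemma fifth_order_constant_solution:
  "\<exists>v. solves_fifth_order \<gamma> \<delta>1 \<delta>2 c B1 (\<lambda>_. v) S \<and> satisfies_elliptic (\<lambda>_. 0) (\<lambda>_. v) S"
proof -
  obtain v where "B1 + (c - 1) * v + (- 3/4) * v\<^sup>2 + 1/4 * v ^ 3 = 0"
    using cubic_surj[of "1/4" B1 "c - 1" "- 3/4" 0] by auto
  then have "1 / 4 * v ^ 3 - 3 / 4 * v\<^sup>2 - (1 - c) * v + B1 = 0"
    by (simp add: algebra_simps)
  then show ?thesis
    by (intro exI[of _ v]) (simp add: solves_fifth_order_def satisfies_elliptic_def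
        times_differentiable_on_const iterated_deriv_const)
qed

section \<open>Elliptic solutions of both reductions\<close>

theorem lemma4:
  shows "\<exists>(a :: real \<Rightarrow> real \<Rightarrow> real \<Rightarrow> real \<Rightarrow> nat \<Rightarrow> real)
          (b :: real \<Rightarrow> real \<Rightarrow> real \<Rightarrow> real \<Rightarrow> real \<Rightarrow> nat \<Rightarrow> real).
      (\<forall>\<nu> c A0 A1. (1 - c) * \<nu> + c / 6 \<noteq> 0 \<longrightarrow>
         (\<exists>u l h. l < h \<and>
            solves_third_order \<nu> c A1 u {l<..<h} \<and>
            has_second_integration_constant \<nu> c A1 A0 u {l<..<h} \<and>
            satisfies_elliptic (a \<nu> c A0 A1) u {l<..<h} \<and>
            \<not> u constant_on {l<..<h})) \<and>
      (\<forall>\<gamma> \<delta>1 \<delta>2 c B1.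
         (\<exists>u l h. l < h \<and>
            solves_fifth_order \<gamma> \<delta>1 \<delta>2 c B1 u {l<..<h} \<and>
            satisfies_elliptic (b \<gamma> \<delta>1 \<delta>2 c B1) u {l<..<h} \<and>
            (nonresonant \<gamma> \<delta>1 \<delta>2 c \<longrightarrow> \<not> u constant_on {l<..<h})))"
proof -
  (* The premise stays inside the existential quantifier for the coefficients, so that the
     axiom of choice yields a function of all parameters. *)
  have third: "\<forall>\<nu> c A0 A1. \<exists>a. (1 - c) * \<nu> + c / 6 \<noteq> 0 \<longrightarrow>
         (\<exists>u l h. l < h \<and>
            solves_third_order \<nu> c A1 u {l<..<h} \<and>
            has_second_integration_constant \<nu> c A1 A0 u {l<..<h} \<and>
            satisfies_elliptic a u {l<..<h} \<and>
            \<not> u constant_on {l<..<h})"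
    using third_order_elliptic_solution by blast
  have fifth: "\<forall>\<gamma> \<delta>1 \<delta>2 c B1. \<exists>b u l h. l < h \<and>
            solves_fifth_order \<gamma> \<delta>1 \<delta>2 c B1 u {l<..<h} \<and>
            satisfies_elliptic b u {l<..<h} \<and>
            (nonresonant \<gamma> \<delta>1 \<delta>2 c \<longrightarrow> \<not> u constant_on {l<..<h})"
    using fifth_order_elliptic_solution_nonresonant fifth_order_constant_solution zero_less_one
    by metis
  from third obtain a where "\<forall>\<nu> c A0 A1. (1 - c) * \<nu> + c / 6 \<noteq> 0 \<longrightarrow>
         (\<exists>u l h. l < h \<and>
            solves_third_order \<nu> c A1 u {l<..<h} \<and>
            has_second_integration_constant \<nu> c A1 A0 u {l<..<h} \<and>
            satisfies_elliptic (a \<nu> c A0 A1) u {l<..<h} \<and>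
            \<not> u constant_on {l<..<h})"
    unfolding choice_iff by blast
  moreover from fifth obtain b where "\<forall>\<gamma> \<delta>1 \<delta>2 c B1. \<exists>u l h. l < h \<and>
            solves_fifth_order \<gamma> \<delta>1 \<delta>2 c B1 u {l<..<h} \<and>
            satisfies_elliptic (b \<gamma> \<delta>1 \<delta>2 c B1) u {l<..<h} \<and>
            (nonresonant \<gamma> \<delta>1 \<delta>2 c \<longrightarrow> \<not> u constant_on {l<..<h})"
    by metis
  ultimately show ?thesis by blast
qed

end
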